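(* Let $K$ be a field of characteristic zero and let $A_1=K\langle X,Y\mid [Y,X]=1\rangle$ be the first Weyl algebra over $K$. If $x,y\in A_1$ are elements with $[y,x]=1$, then $C(yx)=K[yx]$.
   Context: For elements $a,b$ of an algebra, $[a,b]:=ab-ba$. For $a\in A_1$, $C(a):=\{b\in A_1\mid ab=ba\}$ is the centralizer of $a$ in $A_1$, and $K[a]$ denotes the $K$-subalgebra of $A_1$ generated by $a$. *)

theory Defs
  imports "HOL-Library.Poly_Mapping" "HOL-Computational_Algebra.Polynomial"
begin

text \<open>
  The free algebra \<open>K\<langle>X,Y\<rangle>\<close> is the monoid algebra over \<open>K\<close> of the free monoid on two letters:
  finitely supported maps from words to coefficients, multiplied by convolution.  Words are
  wrapped in a datatype so that concatenation can be the addition of an instance of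
  \<^class>\<open>monoid_add\<close>.
\<close>

datatype letter = LX | LY

datatype word = Word (letters: "letter list")

instantiation word :: monoid_add
begin

definition zero_word :: word where "0 = Word []"

definition plus_word :: "word \<Rightarrow> word \<Rightarrow> word" where
  "u + v = Word (letters u @ letters v)"

instance
  by standard (simp_all add: zero_word_def plus_word_def)

end

type_synonym 'k free_algebra = "word \<Rightarrow>\<^sub>0 'k"

definition free_const :: "'k::field_char_0 \<Rightarrow> 'k free_algebra" where
  "free_const c = Poly_Mapping.single 0 c"

definition free_X :: "'k::field_char_0 free_algebra" where
  "free_X = Poly_Mapping.single (Word [LX]) 1"

definition free_Y :: "'k::field_char_0 free_algebra" where
  "free_Y = Poly_Mapping.single (Word [LY]) 1"

definition commutator :: "'a::ring \<Rightarrow> 'a \<Rightarrow> 'a" where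
  "commutator a b = a * b - b * a"

definition two_sided_ideal :: "'a::ring_1 set \<Rightarrow> bool" where
  "two_sided_ideal I \<longleftrightarrow>
     0 \<in> I \<and> (\<forall>a\<in>I. \<forall>b\<in>I. a + b \<in> I) \<and> (\<forall>r. \<forall>a\<in>I. r * a \<in> I \<and> a * r \<in> I)"

definition weyl_ideal :: "'k::field_char_0 free_algebra set" where
  "weyl_ideal = two_sided_ideal hull {commutator free_Y free_X - 1}"

definition weyl_rel :: "'k::field_char_0 free_algebra \<Rightarrow> 'k free_algebra \<Rightarrow> bool" where
  "weyl_rel p q \<longleftrightarrow> p - q \<in> weyl_ideal"

lemma two_sided_ideal_weyl_ideal: "two_sided_ideal weyl_ideal"
  unfolding weyl_ideal_def
  by (rule hull_in) (auto simp: two_sided_ideal_def)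

lemma weyl_ideal_zero: "0 \<in> weyl_ideal"
  and weyl_ideal_add: "p \<in> weyl_ideal \<Longrightarrow> q \<in> weyl_ideal \<Longrightarrow> p + q \<in> weyl_ideal"
  and weyl_ideal_lmult: "p \<in> weyl_ideal \<Longrightarrow> r * p \<in> weyl_ideal"
  and weyl_ideal_rmult: "p \<in> weyl_ideal \<Longrightarrow> p * r \<in> weyl_ideal"
  using two_sided_ideal_weyl_ideal unfolding two_sided_ideal_def by blast+

lemma weyl_ideal_uminus: "p \<in> weyl_ideal \<Longrightarrow> - p \<in> weyl_ideal"
  using weyl_ideal_lmult[of p "- 1"] by simp

lemma equivp_weyl_rel: "equivp (weyl_rel :: 'k::field_char_0 free_algebra \<Rightarrow> _)"
proof (rule equivpI)
  show "reflp (weyl_rel :: 'k free_algebra \<Rightarrow> _)"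
    by (simp add: reflp_def weyl_rel_def weyl_ideal_zero)
  show "symp (weyl_rel :: 'k free_algebra \<Rightarrow> _)"
    unfolding symp_def weyl_rel_def by (metis minus_diff_eq weyl_ideal_uminus)
  show "transp (weyl_rel :: 'k free_algebra \<Rightarrow> _)"
    unfolding transp_def weyl_rel_def using weyl_ideal_add
    by (metis diff_add_cancel add_diff_eq)
qed

text \<open>
  The canonical action on \<open>K[t]\<close> (\<open>X\<close> by multiplication with \<open>t\<close>, \<open>Y\<close> by \<open>d/dt\<close>).  Its only
  purpose here is to show that \<open>1\<close> is not in the ideal, as \<^class>\<open>ring_1\<close> requires \<open>0 \<noteq> 1\<close>.
\<close>

fun word_action :: "letter list \<Rightarrow> 'k::field_char_0 poly \<Rightarrow> 'k poly" where
  "word_action [] f = f"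
| "word_action (LX # w) f = pCons 0 (word_action w f)"
| "word_action (LY # w) f = pderiv (word_action w f)"

definition free_action :: "'k::field_char_0 free_algebra \<Rightarrow> 'k poly \<Rightarrow> 'k poly" where
  "free_action p f =
     (\<Sum>w\<in>Poly_Mapping.keys p. smult (Poly_Mapping.lookup p w) (word_action (letters w) f))"

lemma word_action_append: "word_action (u @ v) f = word_action u (word_action v f)"
  by (induction u f rule: word_action.induct) simp_all

lemma word_action_add: "word_action w (f + g) = word_action w f + word_action w g"
  by (induction w f rule: word_action.induct) (simp_all add: pderiv_add)

lemma word_action_smult: "word_action w (smult c f) = smult c (word_action w f)"
  by (induction w f rule: word_action.induct) (simp_all add: pderiv_smult)

lemma word_action_zero: "word_action w 0 = 0"
  using word_action_smult[of w 0 0] by simp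

lemma free_action_superset:
  assumes "finite A" "Poly_Mapping.keys p \<subseteq> A"
  shows "free_action p f = (\<Sum>w\<in>A. smult (Poly_Mapping.lookup p w) (word_action (letters w) f))"
  unfolding free_action_def using assms
  by (intro sum.mono_neutral_left) (auto simp: in_keys_iff)

lemma free_action_add: "free_action (p + q) f = free_action p f + free_action q f"
proof -
  let ?A = "Poly_Mapping.keys p \<union> Poly_Mapping.keys q"
  have "finite ?A" by simp
  then show ?thesis
    using Poly_Mapping.keys_add[of p q]
    by (simp add: free_action_superset[of ?A] lookup_add smult_add_left sum.distrib)
qed

lemma free_action_single:
  "free_action (Poly_Mapping.single w c) f = smult c (word_action (letters w) f)"
  by (simp add: free_action_superset[of "{w}"])

lemma free_action_one: "free_action 1 f = f"
proof -
  have "letters 0 = []"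
    by (simp add: zero_word_def)
  then show ?thesis
    using free_action_single[of 0 1 f] by simp
qed

lemma free_action_zero: "free_action 0 f = 0"
  by (simp add: free_action_def)

lemma free_action_zero_right: "free_action p 0 = 0"
  by (simp add: free_action_def word_action_zero)

lemma free_action_add_right: "free_action p (f + g) = free_action p f + free_action p g"
  by (simp add: free_action_def word_action_add smult_add_right sum.distrib)

lemma free_algebra_induct [case_names single add]:
  fixes P :: "'k::field_char_0 free_algebra \<Rightarrow> bool"
  assumes single: "\<And>w c. P (Poly_Mapping.single w c)"
    and add: "\<And>p q. P p \<Longrightarrow> P q \<Longrightarrow> P (p + q)"
  shows "P p"
proof (induction p rule: update_induct)
  case const
  show ?case using single[of 0 0] by simp
next
  case (update p w c)
  have "Poly_Mapping.update w c p = p + Poly_Mapping.single w c"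
    using update.hyps
    by (intro poly_mapping_eqI)
      (auto simp: lookup_update lookup_add lookup_single in_keys_iff when_def)
  then show ?case using add[OF update.IH single] by simp
qed

lemma free_action_mult: "free_action (p * q) f = free_action p (free_action q f)"
proof (induction p rule: free_algebra_induct)
  case (single u a)
  show ?case
  proof (induction q rule: free_algebra_induct)
    case (single v b)
    show ?case
      by (simp add: mult_single free_action_single plus_word_def word_action_append
          word_action_smult)
  next
    case (add q q')
    then show ?case
      by (simp add: distrib_left free_action_add free_action_add_right)
  qed
next
  case (add p p')
  then show ?case
    by (simp add: distrib_right free_action_add)
qed

lemma free_action_relator:
  "free_action (commutator free_Y free_X - 1) f = (0 :: 'k::field_char_0 poly)"
proof -
  let ?r = "commutator free_Y free_X - 1 :: 'k free_algebra"
  have "?r + (free_X * free_Y + 1) = free_Y * free_X"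
    by (simp add: commutator_def)
  then have "free_action ?r f + (free_action (free_X * free_Y) f + f) = free_action (free_Y * free_X) f"
    by (metis free_action_add free_action_one)
  also have "\<dots> = pderiv (pCons 0 f)"
    by (simp add: free_action_mult free_X_def free_Y_def free_action_single)
  also have "\<dots> = pCons 0 (pderiv f) + f"
    by (simp add: pderiv_pCons)
  also have "pCons 0 (pderiv f) = free_action (free_X * free_Y) f"
    by (simp add: free_action_mult free_X_def free_Y_def free_action_single)
  finally show ?thesis by simp
qed

lemma free_action_weyl_ideal:
  fixes p :: "'k::field_char_0 free_algebra"
  assumes "p \<in> weyl_ideal"
  shows "free_action p f = 0"
proof -
  let ?I = "{p :: 'k free_algebra. \<forall>f. free_action p f = 0}"
  have "two_sided_ideal ?I"
    by (simp add: two_sided_ideal_def free_action_zero free_action_zero_right free_action_add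
        free_action_mult)
  then have "weyl_ideal \<subseteq> ?I"
    unfolding weyl_ideal_def by (intro hull_minimal) (simp_all add: free_action_relator)
  then show ?thesis using assms by blast
qed

lemma one_notin_weyl_ideal: "1 \<notin> (weyl_ideal :: 'k::field_char_0 free_algebra set)"
proof
  assume "1 \<in> (weyl_ideal :: 'k free_algebra set)"
  then have "free_action (1 :: 'k free_algebra) 1 = 0"
    by (rule free_action_weyl_ideal)
  then show False by (simp add: free_action_one)
qed

quotient_type (overloaded) 'k weyl = "'k::field_char_0 free_algebra" / weyl_rel
  by (rule equivp_weyl_rel)

instantiation weyl :: (field_char_0) ring_1
begin

lift_definition zero_weyl :: "'a weyl" is 0 .

lift_definition one_weyl :: "'a weyl" is 1 .

lift_definition plus_weyl :: "'a weyl \<Rightarrow> 'a weyl \<Rightarrow> 'a weyl" is "(+)"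
  unfolding weyl_rel_def
proof -
  fix p p' q q' :: "'a free_algebra"
  assume "p - p' \<in> weyl_ideal" "q - q' \<in> weyl_ideal"
  then have "(p - p') + (q - q') \<in> weyl_ideal"
    by (rule weyl_ideal_add)
  then show "(p + q) - (p' + q') \<in> weyl_ideal" by (simp add: algebra_simps)
qed

lift_definition uminus_weyl :: "'a weyl \<Rightarrow> 'a weyl" is uminus
  unfolding weyl_rel_def
proof -
  fix p q :: "'a free_algebra"
  assume "p - q \<in> weyl_ideal"
  then have "- (p - q) \<in> weyl_ideal"
    by (rule weyl_ideal_uminus)
  then show "- p - - q \<in> weyl_ideal" by simp
qed

lift_definition minus_weyl :: "'a weyl \<Rightarrow> 'a weyl \<Rightarrow> 'a weyl" is "(-)"
  unfolding weyl_rel_def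
proof -
  fix p p' q q' :: "'a free_algebra"
  assume "p - p' \<in> weyl_ideal" "q - q' \<in> weyl_ideal"
  then have "(p - p') + - (q - q') \<in> weyl_ideal"
    by (intro weyl_ideal_add weyl_ideal_uminus)
  then show "(p - q) - (p' - q') \<in> weyl_ideal" by (simp add: algebra_simps)
qed

lift_definition times_weyl :: "'a weyl \<Rightarrow> 'a weyl \<Rightarrow> 'a weyl" is "(*)"
  unfolding weyl_rel_def
proof -
  fix p p' q q' :: "'a free_algebra"
  assume "p - p' \<in> weyl_ideal" "q - q' \<in> weyl_ideal"
  then have "(p - p') * q + p' * (q - q') \<in> weyl_ideal"
    by (intro weyl_ideal_add weyl_ideal_lmult weyl_ideal_rmult)
  then show "p * q - p' * q' \<in> weyl_ideal" by (simp add: algebra_simps)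
qed

instance
proof
  show "(0 :: 'a weyl) \<noteq> 1"
    by transfer (use one_notin_weyl_ideal weyl_ideal_uminus[of "-1"] in \<open>auto simp: weyl_rel_def\<close>)
qed (transfer, simp add: weyl_rel_def weyl_ideal_zero algebra_simps)+

end

lift_definition weyl_X :: "'k::field_char_0 weyl" is free_X .

lift_definition weyl_Y :: "'k::field_char_0 weyl" is free_Y .

lemma weyl_relation: "commutator weyl_Y weyl_X = (1 :: 'k::field_char_0 weyl)"
  unfolding commutator_def
proof transfer
  show "weyl_rel (free_Y * free_X - free_X * free_Y) (1 :: 'k free_algebra)"
    unfolding weyl_rel_def weyl_ideal_def commutator_def by (rule hull_inc) simp
qed

lift_definition weyl_scale :: "'k::field_char_0 \<Rightarrow> 'k weyl \<Rightarrow> 'k weyl" is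
  "\<lambda>c p. free_const c * p"
  unfolding weyl_rel_def by (metis weyl_ideal_lmult right_diff_distrib)

lemma free_const_add: "free_const (a + b) = free_const a + free_const b"
  by (simp add: free_const_def single_add)

lemma free_const_mult: "free_const (a * b) = free_const a * free_const b"
  by (simp add: free_const_def mult_single)

lemma free_const_one: "free_const 1 = 1"
  by (simp add: free_const_def)

interpretation weyl: vector_space "weyl_scale :: 'k::field_char_0 \<Rightarrow> 'k weyl \<Rightarrow> 'k weyl"
  by standard
    (transfer, simp add: weyl_rel_def weyl_ideal_zero free_const_add free_const_mult
      free_const_one algebra_simps)+

definition subalgebra :: "'k::field_char_0 weyl set \<Rightarrow> bool" where
  "subalgebra S \<longleftrightarrow> weyl.subspace S \<and> 1 \<in> S \<and> (\<forall>a\<in>S. \<forall>b\<in>S. a * b \<in> S)"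

definition generated_subalgebra :: "'k::field_char_0 weyl \<Rightarrow> 'k weyl set" where
  "generated_subalgebra a = subalgebra hull {a}"

definition centralizer :: "'k::field_char_0 weyl \<Rightarrow> 'k weyl set" where
  "centralizer a = {b. a * b = b * a}"

end

theory Submission
  imports Defs
begin

text \<open>
  Filter \<open>A\<^sub>1 = K[X]\<langle>Y\<rangle>\<close> by the order \<open>ord\<close> in \<open>Y\<close>, put \<open>z = yx\<close>, \<open>C = C(z)\<close>, \<open>D = [y, \<cdot>]\<close>.  Two
  elements of \<open>C\<close> of equal order have leading coefficients with vanishing Wronskian, so these
  are proportional; it therefore suffices that \<open>ord z\<close> divides \<open>ord b\<close> for every \<open>b \<in> C\<close>.

  The key point is \<open>ord (D b) = ord b + ord y - ord z\<close> for nonconstant \<open>b \<in> C\<close>.  The difference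
  \<open>ord (D b) - ord b\<close> is bounded on \<open>C\<close>; if its maximum exceeded the value \<open>ord y - ord z\<close> taken at
  \<open>z\<close> (as \<open>D z = y\<close>), then writing a power of a maximizer as \<open>b\<^sup>n = c z\<^sup>m + r\<close> with \<open>r \<in> C\<close> of lower
  order, \<open>r\<close> would give a larger value.  The same relation then yields equality.

  Both \<open>e = (D b) x\<close> and \<open>w = [x, D b]\<close> lie in \<open>C\<close>, and \<open>w x y = - x D e\<close>.  Comparing orders gives
  \<open>ord w = ord b - ord z\<close>, and divisibility follows by descent.
\<close>

section \<open>Scalars and induction over monomials\<close>

lemma weyl_scale_mult_left: "weyl_scale c a * b = weyl_scale c (a * b)"
  by transfer (simp add: weyl_rel_def weyl_ideal_zero mult.assoc)

lemma free_const_commute: "p * free_const c = free_const c * p"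
proof (induction p rule: free_algebra_induct)
  case (single w a)
  show ?case by (simp add: free_const_def mult_single mult.commute)
next
  case (add p q)
  then show ?case by (simp add: algebra_simps)
qed

lemma weyl_scale_mult_right: "a * weyl_scale c b = weyl_scale c (a * b)"
  by transfer (metis free_const_commute mult.assoc weyl_rel_def diff_self weyl_ideal_zero)

text \<open>Monomials arise from \<open>1\<close> by multiplying by generators on the left, and they
  span. Only left multiplications occur, which are the ones easily computed on normal forms.\<close>

lemma weyl_induct [case_names one add scale X Y]:
  fixes P :: "'k::field_char_0 weyl \<Rightarrow> bool"
  assumes one: "P 1"
    and add: "\<And>a b. P a \<Longrightarrow> P b \<Longrightarrow> P (a + b)"
    and scale: "\<And>c a. P a \<Longrightarrow> P (weyl_scale c a)"
    and X: "\<And>a. P a \<Longrightarrow> P (weyl_X * a)"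
    and Y: "\<And>a. P a \<Longrightarrow> P (weyl_Y * a)"
  shows "P a"
proof -
  have word: "P (abs_weyl (Poly_Mapping.single (Word w) 1))" for w
  proof (induction w)
    case Nil
    show ?case
      using one by (simp add: one_weyl_def zero_word_def[symmetric])
  next
    case (Cons l w)
    have "Poly_Mapping.single (Word (l # w)) 1 =
        (case l of LX \<Rightarrow> free_X | LY \<Rightarrow> free_Y) * Poly_Mapping.single (Word w) (1::'k)"
      by (cases l) (simp_all add: free_X_def free_Y_def mult_single plus_word_def)
    then show ?case
      using X[OF Cons] Y[OF Cons]
      by (cases l) (simp_all add: weyl_X_def weyl_Y_def times_weyl.abs_eq)
  qed
  obtain p where a: "a = abs_weyl p"
    by (metis Quotient_abs_rep Quotient_weyl)
  show ?thesis
    unfolding a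
  proof (induction p rule: free_algebra_induct)
    case (single w c)
    have "Poly_Mapping.single w c = free_const c * Poly_Mapping.single (Word (letters w)) 1"
      by (simp add: free_const_def mult_single)
    then show ?case
      using scale[OF word, of c "letters w"] by (simp add: weyl_scale.abs_eq)
  next
    case (add p q)
    then show ?case
      using assms(2) by (simp add: plus_weyl.abs_eq[symmetric])
  qed
qed

section \<open>The action on K[t] and the subalgebra K[X]\<close>

lift_definition weyl_action :: "'k::field_char_0 weyl \<Rightarrow> 'k poly \<Rightarrow> 'k poly" is free_action
proof
  fix p q :: "'k free_algebra" and f
  assume "weyl_rel p q"
  then have "free_action (p - q) f = 0"
    by (simp add: weyl_rel_def free_action_weyl_ideal)
  then show "free_action p f = free_action q f"
    using free_action_add[of "p - q" q f] by simp
qed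

lemma weyl_action_add: "weyl_action (a + b) f = weyl_action a f + weyl_action b f"
  by transfer (rule free_action_add)

lemma weyl_action_mult: "weyl_action (a * b) f = weyl_action a (weyl_action b f)"
  by transfer (rule free_action_mult)

lemma weyl_action_zero: "weyl_action 0 f = 0"
  by transfer (rule free_action_zero)

lemma weyl_action_zero_right: "weyl_action a 0 = 0"
  by transfer (rule free_action_zero_right)

lemma weyl_action_const: "weyl_action (weyl_scale c 1) f = smult c f"
  by transfer (simp add: free_const_def free_action_single zero_word_def)

lemma weyl_action_X: "weyl_action weyl_X f = pCons 0 f"
  by transfer (simp add: free_X_def free_action_single)

lemma weyl_action_Y: "weyl_action weyl_Y f = pderiv f"
  by transfer (simp add: free_Y_def free_action_single)

definition weyl_of_poly :: "'k::field_char_0 poly \<Rightarrow> 'k weyl" where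
  "weyl_of_poly p = fold_coeffs (\<lambda>c a. weyl_scale c 1 + weyl_X * a) p 0"

lemma weyl_of_poly_0 [simp]: "weyl_of_poly 0 = 0"
  by (simp add: weyl_of_poly_def)

lemma weyl_of_poly_pCons [simp]:
  "weyl_of_poly (pCons c p) = weyl_scale c 1 + weyl_X * weyl_of_poly p"
  by (cases "c = 0 \<and> p = 0") (auto simp: weyl_of_poly_def)

lemma weyl_of_poly_add: "weyl_of_poly (p + q) = weyl_of_poly p + weyl_of_poly q"
  by (induction p q rule: poly_induct2) (simp_all add: weyl.scale_left_distrib algebra_simps)

lemma weyl_of_poly_smult: "weyl_of_poly (smult c p) = weyl_scale c (weyl_of_poly p)"
  by (induction p) (simp_all add: weyl.scale_right_distrib weyl_scale_mult_right)

lemma weyl_of_poly_mult: "weyl_of_poly (p * q) = weyl_of_poly p * weyl_of_poly q"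
  by (induction p)
    (simp_all add: weyl_of_poly_add weyl_of_poly_smult weyl_scale_mult_left distrib_right mult.assoc)

lemma weyl_of_poly_commute: "weyl_of_poly p * weyl_of_poly q = weyl_of_poly q * weyl_of_poly p"
  by (simp flip: weyl_of_poly_mult add: mult.commute)

lemma weyl_of_poly_1: "weyl_of_poly 1 = 1"
  by (simp add: one_pCons)

lemma weyl_action_of_poly: "weyl_action (weyl_of_poly p) f = p * f"
  by (induction p)
    (simp_all add: weyl_action_zero weyl_action_add weyl_action_mult weyl_action_const weyl_action_X)

text \<open>This is [Y, p] = p', the rule for moving Y to the right of a polynomial in X; the
  induction follows the Horner scheme and uses YX = XY + 1.\<close>

lemma weyl_Y_mult_of_poly:
  "weyl_Y * weyl_of_poly p = weyl_of_poly p * weyl_Y + weyl_of_poly (pderiv p)"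
proof (induction p)
  case 0
  show ?case by simp
next
  case (pCons c p)
  have "weyl_Y * weyl_X = weyl_X * weyl_Y + (1 :: 'a weyl)"
    using weyl_relation by (simp add: commutator_def algebra_simps)
  then have "(weyl_Y * weyl_X) * weyl_of_poly p = (weyl_X * weyl_Y + 1) * weyl_of_poly p"
    by simp
  then have "weyl_Y * (weyl_X * weyl_of_poly p)
      = weyl_X * (weyl_Y * weyl_of_poly p) + weyl_of_poly p"
    by (simp add: distrib_right mult.assoc)
  then show ?case
    by (simp add: pCons.IH pderiv_pCons weyl_of_poly_add weyl_scale_mult_left
        weyl_scale_mult_right algebra_simps)
qed

section \<open>Normal forms and coefficients with respect to Y\<close>

text \<open>The outer variable stands for Y, and coefficients are written to the left of its powers.
  Type \<open>'k poly poly\<close> serves as an additive container only: its commutative product is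
  not the product of the Weyl algebra.\<close>

definition normal_form :: "'k::field_char_0 poly poly \<Rightarrow> 'k weyl" where
  "normal_form P = fold_coeffs (\<lambda>p a. weyl_of_poly p + a * weyl_Y) P 0"

lemma normal_form_0 [simp]: "normal_form 0 = 0"
  by (simp add: normal_form_def)

lemma normal_form_pCons [simp]:
  "normal_form (pCons p P) = weyl_of_poly p + normal_form P * weyl_Y"
  by (cases "p = 0 \<and> P = 0") (auto simp: normal_form_def)

lemma normal_form_add: "normal_form (P + Q) = normal_form P + normal_form Q"
  by (induction P Q rule: poly_induct2) (simp_all add: weyl_of_poly_add algebra_simps)

lemma normal_form_smult: "normal_form (smult p P) = weyl_of_poly p * normal_form P"
  by (induction P) (simp_all add: weyl_of_poly_mult distrib_left mult.assoc)

text \<open>Left multiplication by Y, transported to normal forms.\<close>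

definition deriv_shift :: "'k::field_char_0 poly poly \<Rightarrow> 'k poly poly" where
  "deriv_shift P = pCons 0 P + map_poly pderiv P"

lemma normal_form_deriv_shift: "normal_form (deriv_shift P) = weyl_Y * normal_form P"
proof (induction P)
  case 0
  show ?case by (simp add: deriv_shift_def)
next
  case (pCons p P)
  have "map_poly pderiv (pCons p P) = pCons (pderiv p) (map_poly pderiv P)"
    by (rule map_poly_pCons) simp
  then show ?case
    using pCons.IH
    by (simp add: deriv_shift_def normal_form_add weyl_Y_mult_of_poly algebra_simps
        flip: mult.assoc distrib_right)
qed

lemma pderiv_surj: "\<exists>g. pderiv g = (f :: 'k::field_char_0 poly)"
proof -
  have "pderiv (\<Sum>i\<le>degree f. monom (coeff f i / of_nat (Suc i)) (Suc i)) =
      (\<Sum>i\<le>degree f. monom (coeff f i) i)"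
    by (simp add: higher_pderiv_sum[where n = 1, simplified] pderiv_monom del: of_nat_Suc)
  then show ?thesis
    by (metis poly_as_sum_of_monoms)
qed

text \<open>Acting on \<open>1\<close> isolates the coefficient \<open>p\<close> of Y^0, because
  derivatives of \<open>1\<close> vanish. Once \<open>p = 0\<close>, the rest acts after d/dt, which
  is onto in characteristic zero, so it acts as zero on every polynomial.\<close>

lemma normal_form_faithful:
  "(\<And>f. weyl_action (normal_form P) f = 0) \<Longrightarrow> P = 0"
proof (induction P)
  case 0
  show ?case by simp
next
  case (pCons p P)
  have act: "p * f + weyl_action (normal_form P) (pderiv f) = 0" for f
    using pCons.prems[of f]
    by (simp add: weyl_action_add weyl_action_mult weyl_action_of_poly weyl_action_Y)
  have p: "p = 0"
    using act[of 1] by (simp add: weyl_action_zero_right)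
  then have "weyl_action (normal_form P) f = 0" for f
    using act pderiv_surj[of f] by auto
  with p pCons.IH show ?case by simp
qed

lemma normal_form_eq_0_iff: "normal_form P = 0 \<longleftrightarrow> P = 0"
  using normal_form_faithful[of P] by (auto simp: weyl_action_zero)

lemma inj_normal_form: "inj normal_form"
proof (rule injI)
  fix P Q :: "'k::field_char_0 poly poly"
  assume "normal_form P = normal_form Q"
  then have "normal_form (P - Q) = 0"
    using normal_form_add[of "P - Q" Q] by simp
  then show "P = Q" by (simp add: normal_form_eq_0_iff)
qed

lemma surj_normal_form: "\<exists>P. normal_form P = a"
proof (induction a rule: weyl_induct)
  case one
  have "normal_form [:1:] = 1"
    by (simp only: normal_form_pCons normal_form_0 weyl_of_poly_1) simp
  then show ?case ..
next
  case (add a b)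
  then show ?case using normal_form_add by metis
next
  case (scale c a)
  then obtain P where "normal_form P = a" ..
  then have "normal_form (smult [:c:] P) = weyl_scale c a"
    by (simp add: normal_form_smult weyl_scale_mult_left)
  then show ?case ..
next
  case (X a)
  then obtain P where "normal_form P = a" ..
  then have "normal_form (smult [:0, 1:] P) = weyl_X * a"
    by (simp add: normal_form_smult)
  then show ?case ..
next
  case (Y a)
  then show ?case using normal_form_deriv_shift by metis
qed

text \<open>
  Integer indices let the expansion of a product below refer to the coefficient one below the
  leading one even when the order is \<open>0\<close>.
\<close>

definition coeff_Y :: "'k::field_char_0 weyl \<Rightarrow> int \<Rightarrow> 'k poly" where
  "coeff_Y a k = (if k < 0 then 0 else coeff (inv normal_form a) (nat k))"

lemma inv_normal_form [simp]: "inv normal_form (normal_form P) = P"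
  by (rule inv_f_f[OF inj_normal_form])

lemma inv_normal_form_0 [simp]: "inv normal_form 0 = 0"
  by (metis inv_normal_form normal_form_0)

lemma normal_form_inv [simp]: "normal_form (inv normal_form a) = a"
  by (metis inv_normal_form surj_normal_form)

lemma coeff_Y_normal_form: "coeff_Y (normal_form P) k = (if k < 0 then 0 else coeff P (nat k))"
  by (simp add: coeff_Y_def)

lemma coeff_Y_neg: "k < 0 \<Longrightarrow> coeff_Y a k = 0"
  by (simp add: coeff_Y_def)

lemma coeff_Y_0 [simp]: "coeff_Y 0 k = 0"
  by (simp add: coeff_Y_def)

lemma coeff_Y_add [simp]: "coeff_Y (a + b) k = coeff_Y a k + coeff_Y b k"
proof -
  obtain P Q where "a = normal_form P" "b = normal_form Q"
    using surj_normal_form by metis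
  then show ?thesis
    by (simp add: coeff_Y_normal_form flip: normal_form_add)
qed

lemma coeff_Y_diff [simp]: "coeff_Y (a - b) k = coeff_Y a k - coeff_Y b k"
  using coeff_Y_add[of "a - b" b k] by simp

lemma coeff_Y_of_poly_mult: "coeff_Y (weyl_of_poly p * a) k = p * coeff_Y a k"
proof -
  obtain P where "a = normal_form P"
    using surj_normal_form by metis
  then show ?thesis
    by (simp add: coeff_Y_normal_form flip: normal_form_smult)
qed

lemma coeff_Y_scale [simp]: "coeff_Y (weyl_scale c a) k = smult c (coeff_Y a k)"
  using coeff_Y_of_poly_mult[of "[:c:]" a k] by (simp add: weyl_scale_mult_left)

lemma coeff_Y_Y_mult: "coeff_Y (weyl_Y * a) k = coeff_Y a (k - 1) + pderiv (coeff_Y a k)"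
proof -
  obtain P where a: "a = normal_form P"
    using surj_normal_form by metis
  have "nat k = Suc (nat (k - 1))" if "k > 0"
    using that by simp
  then show ?thesis
    unfolding a normal_form_deriv_shift[symmetric] coeff_Y_normal_form
    by (cases "k > 0") (auto simp: deriv_shift_def coeff_map_poly)
qed

lemma coeff_Y_normal_form_pCons:
  "coeff_Y (normal_form (pCons p P)) k = (if k = 0 then p else coeff_Y (normal_form P) (k - 1))"
proof -
  have "nat k = Suc (nat (k - 1))" if "k > 0"
    using that by simp
  then show ?thesis
    by (cases "k > 0") (auto simp: coeff_Y_normal_form simp del: normal_form_pCons)
qed

section \<open>The order filtration and leading coefficients\<close>

definition order_le :: "'k::field_char_0 weyl \<Rightarrow> int \<Rightarrow> bool" where
  "order_le a n \<longleftrightarrow> (\<forall>k>n. coeff_Y a k = 0)"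

lemma order_leD: "order_le a n \<Longrightarrow> n < k \<Longrightarrow> coeff_Y a k = 0"
  by (simp add: order_le_def)

lemma order_le_mono: "order_le a n \<Longrightarrow> n \<le> m \<Longrightarrow> order_le a m"
  by (simp add: order_le_def)

lemma order_le_0 [simp]: "order_le 0 n"
  by (simp add: order_le_def)

lemma order_le_add: "order_le a n \<Longrightarrow> order_le b n \<Longrightarrow> order_le (a + b) n"
  by (simp add: order_le_def)

lemma order_le_diff: "order_le a n \<Longrightarrow> order_le b n \<Longrightarrow> order_le (a - b) n"
  by (simp add: order_le_def)

lemma order_le_scale: "order_le a n \<Longrightarrow> order_le (weyl_scale c a) n"
  by (simp add: order_le_def)

text \<open>Induction on the left factor: its constant term is split off and one Y is handed over to
  \<open>b\<close>, so the bounds \<open>(n, m)\<close> become \<open>(n - 1, m + 1)\<close>. Bounds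
  instead of exact orders keep the induction free of nonvanishing conditions. The derivative term in
  the third claim comes from moving one of the \<open>n\<close> factors Y past the leading
  coefficient of \<open>b\<close>.\<close>

lemma mult_expansion:
  assumes "order_le a n" "order_le b m"
  shows "order_le (a * b) (n + m)"
    and "coeff_Y (a * b) (n + m) = coeff_Y a n * coeff_Y b m"
    and "coeff_Y (a * b) (n + m - 1) = coeff_Y a n * coeff_Y b (m - 1)
           + coeff_Y a (n - 1) * coeff_Y b m + of_int n * coeff_Y a n * pderiv (coeff_Y b m)"
proof -
  have "order_le (normal_form P * b) (n + m)
      \<and> coeff_Y (normal_form P * b) (n + m) = coeff_Y (normal_form P) n * coeff_Y b m
      \<and> coeff_Y (normal_form P * b) (n + m - 1) = coeff_Y (normal_form P) n * coeff_Y b (m - 1)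
           + coeff_Y (normal_form P) (n - 1) * coeff_Y b m
           + of_int n * coeff_Y (normal_form P) n * pderiv (coeff_Y b m)"
    if "order_le (normal_form P) n" "order_le b m" for P
    using that
  proof (induction P arbitrary: n b m)
    case 0
    show ?case by simp
  next
    case (pCons p P)
    have P: "order_le (normal_form P) (n - 1)"
      unfolding order_le_def
    proof (intro allI impI)
      fix k assume "n - 1 < k"
      then have "coeff_Y (normal_form (pCons p P)) (k + 1) = 0"
        using pCons.prems(1) by (simp add: order_le_def del: normal_form_pCons)
      then show "coeff_Y (normal_form P) k = 0"
        \<comment> \<open>At \<open>k = -1\<close> the shifted index is 0 and picks out
          \<open>p\<close>, so the convention that negative indices give 0 is used instead.\<close>
        by (cases "k = -1")
          (simp_all add: coeff_Y_neg coeff_Y_normal_form_pCons del: normal_form_pCons)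
    qed
    have Yb: "order_le (weyl_Y * b) (m + 1)"
      using pCons.prems(2) by (simp add: order_le_def coeff_Y_Y_mult)
    have p: "p = 0" if "n < 0"
      using order_leD[OF pCons.prems(1) that]
      by (simp add: coeff_Y_normal_form_pCons del: normal_form_pCons)
    have prod: "coeff_Y (normal_form (pCons p P) * b) k
        = p * coeff_Y b k + coeff_Y (normal_form P * (weyl_Y * b)) k" for k
      by (simp add: distrib_right mult.assoc coeff_Y_of_poly_mult)
    have bm: "coeff_Y b k = 0" if "m < k" for k
      using pCons.prems(2) that by (rule order_leD)
    note IH = pCons.IH[OF P Yb]
    have IH1: "coeff_Y (normal_form P * (weyl_Y * b)) k = 0" if "n + m < k" for k
      using IH that by (simp add: order_le_def)
    have IH2: "coeff_Y (normal_form P * (weyl_Y * b)) (n + m)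
        = coeff_Y (normal_form P) (n - 1) * coeff_Y b m"
      using IH by (simp add: coeff_Y_Y_mult bm)
    \<comment> \<open>The coefficient of \<open>weyl_Y * b\<close> at \<open>m\<close> contains
      \<open>pderiv (coeff_Y b m)\<close>, which raises the factor \<open>n - 1\<close> of the
      induction hypothesis to \<open>n\<close>.\<close>
    have IH3: "coeff_Y (normal_form P * (weyl_Y * b)) (n + m - 1)
        = coeff_Y (normal_form P) (n - 1) * coeff_Y b (m - 1)
          + coeff_Y (normal_form P) (n - 2) * coeff_Y b m
          + of_int n * coeff_Y (normal_form P) (n - 1) * pderiv (coeff_Y b m)"
      using IH by (simp add: coeff_Y_Y_mult bm algebra_simps)
    have "order_le (normal_form (pCons p P) * b) (n + m)"
      unfolding order_le_def prod using p bm IH1 by (cases "n < 0") auto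
    moreover have "coeff_Y (normal_form (pCons p P) * b) (n + m)
        = coeff_Y (normal_form (pCons p P)) n * coeff_Y b m"
      unfolding prod IH2 coeff_Y_normal_form_pCons
      using p bm[of "n + m"] by (cases n "0 :: int" rule: linorder_cases) (auto simp: coeff_Y_neg)
    moreover have "coeff_Y (normal_form (pCons p P) * b) (n + m - 1)
        = coeff_Y (normal_form (pCons p P)) n * coeff_Y b (m - 1)
          + coeff_Y (normal_form (pCons p P)) (n - 1) * coeff_Y b m
          + of_int n * coeff_Y (normal_form (pCons p P)) n * pderiv (coeff_Y b m)"
    proof -
      consider "n < 0" | "n = 0" | "n = 1" | "n > 1" by linarith
      then show ?thesis
        unfolding prod IH3 coeff_Y_normal_form_pCons
        using p bm[of "n + m - 1"] by cases (auto simp: coeff_Y_neg)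
    qed
    ultimately show ?case by blast
  qed
  from this[of "inv normal_form a"] assms
  show "order_le (a * b) (n + m)"
    and "coeff_Y (a * b) (n + m) = coeff_Y a n * coeff_Y b m"
    and "coeff_Y (a * b) (n + m - 1) = coeff_Y a n * coeff_Y b (m - 1)
           + coeff_Y a (n - 1) * coeff_Y b m + of_int n * coeff_Y a n * pderiv (coeff_Y b m)"
    by simp_all
qed

text \<open>Zero gets order 0 here, whereas \<open>order_le 0 n\<close> holds for every
  \<open>n\<close>, even negative. Remainders that may vanish are therefore controlled by
  \<open>order_le\<close>.\<close>

definition ord :: "'k::field_char_0 weyl \<Rightarrow> int" where
  "ord a = int (degree (inv normal_form a))"

definition lead :: "'k::field_char_0 weyl \<Rightarrow> 'k poly" where
  "lead a = coeff_Y a (ord a)"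

lemma ord_nonneg: "0 \<le> ord a"
  by (simp add: ord_def)

lemma order_le_ord: "order_le a (ord a)"
  unfolding order_le_def ord_def coeff_Y_def
  by (auto intro!: coeff_eq_0)

lemma lead_nonzero: "a \<noteq> 0 \<Longrightarrow> lead a \<noteq> 0"
  unfolding lead_def ord_def coeff_Y_def
  by (simp, metis normal_form_0 normal_form_inv)

lemma lead_eqI:
  assumes "order_le a n" "coeff_Y a n \<noteq> 0"
  shows "a \<noteq> 0" "ord a = n" "lead a = coeff_Y a n"
proof -
  show a: "a \<noteq> 0" using assms by auto
  show "ord a = n"
    using lead_nonzero[OF a] assms order_le_ord[of a]
    unfolding lead_def order_le_def by (meson linorder_neqE)
  then show "lead a = coeff_Y a n" by (simp add: lead_def)
qed

lemma order_le_iff: "order_le a n \<longleftrightarrow> a = 0 \<or> ord a \<le> n"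
  using lead_nonzero[of a] order_le_ord[of a] order_le_mono[of a "ord a" n] order_leD[of a n "ord a"]
  by (cases "a = 0"; cases "ord a \<le> n") (auto simp: lead_def)

lemma mult_lead:
  assumes "a \<noteq> 0" "b \<noteq> 0"
  shows "a * b \<noteq> 0" "ord (a * b) = ord a + ord b" "lead (a * b) = lead a * lead b"
proof -
  have prod: "coeff_Y (a * b) (ord a + ord b) = lead a * lead b"
    unfolding lead_def by (rule mult_expansion(2)[OF order_le_ord order_le_ord])
  then have "coeff_Y (a * b) (ord a + ord b) \<noteq> 0"
    using lead_nonzero[OF assms(1)] lead_nonzero[OF assms(2)] by simp
  from lead_eqI[OF mult_expansion(1)[OF order_le_ord order_le_ord] this] prod
  show "a * b \<noteq> 0" "ord (a * b) = ord a + ord b" "lead (a * b) = lead a * lead b"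
    by simp_all
qed

instance weyl :: (field_char_0) ring_1_no_zero_divisors
  by standard (rule mult_lead)

lemma ord_1 [simp]: "ord (1 :: 'k::field_char_0 weyl) = 0"
  using mult_lead(2)[of 1 "1 :: 'k weyl"] by simp

lemma coeff_Y_1 [simp]: "coeff_Y 1 0 = (1 :: 'k::field_char_0 poly)"
proof -
  have "normal_form [:1:] = (1 :: 'k weyl)"
    by (simp only: normal_form_pCons normal_form_0 weyl_of_poly_1) simp
  then show ?thesis
    using coeff_Y_normal_form[of "[:1 :: 'k poly:]" 0] by (simp del: normal_form_pCons)
qed

lemma ord_power: "a \<noteq> 0 \<Longrightarrow> ord (a ^ n) = int n * ord a"
  by (induction n) (simp_all add: mult_lead algebra_simps)

lemma ord_scale: "c \<noteq> 0 \<Longrightarrow> ord (weyl_scale c a) = ord a"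
  using lead_eqI(2)[OF order_le_scale[OF order_le_ord], of c a] lead_nonzero[of a]
  by (cases "a = 0") (simp_all add: lead_def)

lemma ord_add_lower:
  assumes "a \<noteq> 0" "order_le b n" "n < ord a"
  shows "a + b \<noteq> 0" "ord (a + b) = ord a"
proof -
  have "order_le (a + b) (ord a)"
    using assms order_le_ord by (intro order_le_add order_le_mono[OF assms(2)]) auto
  moreover have "coeff_Y (a + b) (ord a) \<noteq> 0"
    using lead_nonzero[OF assms(1)] order_leD[OF assms(2,3)] by (simp add: lead_def)
  ultimately show "a + b \<noteq> 0" "ord (a + b) = ord a"
    by (rule lead_eqI)+
qed

lemma ord_0E:
  assumes "ord a = 0"
  obtains p where "a = weyl_of_poly p"
proof -
  have "degree (inv normal_form a) = 0"
    using assms by (simp add: ord_def)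
  then obtain p where "inv normal_form a = [:p:]"
    by (rule degree_eq_zeroE)
  then have "a = normal_form [:p:]"
    by (metis normal_form_inv)
  with that show ?thesis by simp
qed

section \<open>Wronskians and commuting elements\<close>

text \<open>For nonconstant polynomials the leading coefficients of the two sides differ only by the
  factors \<open>degree f\<close> and \<open>degree g\<close>, which characteristic zero
  distinguishes. If one polynomial is constant, the equation kills the derivative of the
  other.\<close>

lemma degree_eq_of_wronskian:
  fixes f g :: "'k::field_char_0 poly"
  assumes eq: "pderiv f * g = f * pderiv g" and "f \<noteq> 0" "g \<noteq> 0"
  shows "degree f = degree g"
proof (cases "degree f = 0 \<or> degree g = 0")
  case True
  then have "pderiv f = 0 \<or> pderiv g = 0"
    by (simp add: pderiv_eq_0_iff)
  then have "pderiv f = 0 \<and> pderiv g = 0"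
    using assms by auto
  then show ?thesis by (simp add: pderiv_eq_0_iff)
next
  case False
  have lead: "lead_coeff (pderiv p) = of_nat (degree p) * lead_coeff p"
    if "degree p \<noteq> 0" for p :: "'k poly"
    using that by (simp add: degree_pderiv coeff_pderiv)
  have "lead_coeff (pderiv f) * lead_coeff g = lead_coeff f * lead_coeff (pderiv g)"
    using arg_cong[OF eq, of lead_coeff] by (simp only: lead_coeff_mult)
  then show ?thesis
    using False assms(2,3) lead by simp
qed

text \<open>Subtracting the multiple of \<open>g\<close> that cancels the leading term preserves the
  equation. A nonzero remainder would again have the degree of \<open>g\<close>, where its
  coefficient is 0.\<close>

lemma proportional_of_wronskian:
  fixes f g :: "'k::field_char_0 poly"
  assumes eq: "pderiv f * g = f * pderiv g" and "f \<noteq> 0" "g \<noteq> 0"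
  obtains c where "c \<noteq> 0" "f = smult c g"
proof
  let ?c = "lead_coeff f / lead_coeff g"
  show "?c \<noteq> 0" using assms by simp
  let ?r = "f - smult ?c g"
  have "pderiv ?r * g = ?r * pderiv g"
    using eq by (simp add: pderiv_diff pderiv_smult algebra_simps)
  moreover have "coeff ?r (degree g) = 0"
    using degree_eq_of_wronskian[OF assms] assms by simp
  ultimately have "?r = 0"
    using degree_eq_of_wronskian[of ?r g] \<open>g \<noteq> 0\<close> by (metis leading_coeff_0_iff)
  then show "f = smult ?c g" by simp
qed

text \<open>At the index just below the top, the products of leading and subleading coefficients
  agree for \<open>a * b\<close> and \<open>b * a\<close>; only the derivative terms remain.\<close>

lemma lead_commute:
  assumes "a * b = b * a"
  shows "of_int (ord a) * lead a * pderiv (lead b) = of_int (ord b) * lead b * pderiv (lead a)"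
  using arg_cong[OF assms, of "\<lambda>c. coeff_Y c (ord a + ord b - 1)"]
    mult_expansion(3)[OF order_le_ord order_le_ord, of a b]
    mult_expansion(3)[OF order_le_ord order_le_ord, of b a]
  by (simp add: lead_def algebra_simps)

lemma commuting_proportional:
  assumes z: "0 < ord z" and comm: "z * a = a * z" "z * b = b * z"
    and nz: "a \<noteq> 0" "b \<noteq> 0" and ord: "ord a = ord b"
  obtains c where "c \<noteq> 0" "order_le (a - weyl_scale c b) (ord b - 1)"
proof -
  have "z \<noteq> 0" using z by (auto simp: ord_def)
  let ?h = "of_int (ord z) * lead z"
  have h: "?h \<noteq> 0" using z lead_nonzero[OF \<open>z \<noteq> 0\<close>] by simp
  \<comment> \<open>Both sides reduce to \<open>pderiv (lead z)\<close> times the same product,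
    since \<open>a\<close> and \<open>b\<close> have equal order.\<close>
  have "?h * (pderiv (lead a) * lead b) = ?h * (lead a * pderiv (lead b))"
    using lead_commute[OF comm(1)] lead_commute[OF comm(2)] ord by (simp add: algebra_simps)
  then have "pderiv (lead a) * lead b = lead a * pderiv (lead b)"
    using h by (simp only: mult_cancel_left) simp
  then obtain c where c: "c \<noteq> 0" "lead a = smult c (lead b)"
    using proportional_of_wronskian lead_nonzero nz by metis
  have "coeff_Y (a - weyl_scale c b) k = 0" if "k > ord b - 1" for k
  proof (cases "k = ord b")
    case True
    then show ?thesis using c ord by (simp add: lead_def)
  next
    case False
    then show ?thesis
      using that ord order_le_ord[of a] order_le_ord[of b] by (simp add: order_le_def)
  qed
  with c that show ?thesis by (simp add: order_le_def)
qed

section \<open>Commutators with powers\<close>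

lemma commutator_add_right: "commutator a (b + c) = commutator a b + commutator a (c :: 'a::ring)"
  by (simp add: commutator_def algebra_simps)

lemma commutator_scale_right:
  "commutator a (weyl_scale c b) = weyl_scale c (commutator a b)"
  by (simp add: commutator_def weyl_scale_mult_left weyl_scale_mult_right
      weyl.scale_right_diff_distrib)

lemma commutator_mult_right:
  "commutator a (b * c) = commutator a b * c + b * commutator a (c :: 'a::ring)"
  by (simp add: commutator_def algebra_simps)

text \<open>By the Leibniz rule the commutator is a sum of \<open>n + 1\<close> products in which
  one factor \<open>b\<close> is replaced by \<open>commutator a b\<close>. They share the same top
  coefficient, so in characteristic zero nothing cancels.\<close>

lemma commutator_power_right_expansion:
  fixes a b :: "'k::field_char_0 weyl"
  defines "s \<equiv> ord b" and "t \<equiv> ord (commutator a b)"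
  shows "order_le (commutator a (b ^ Suc n)) (int n * s + t) \<and>
    coeff_Y (commutator a (b ^ Suc n)) (int n * s + t)
      = of_nat (Suc n) * lead b ^ n * lead (commutator a b)"
proof (induction n)
  case 0
  show ?case by (simp add: t_def order_le_ord lead_def)
next
  case (Suc n)
  let ?D = "commutator a" and ?N = "int (Suc n) * s + t"
  have pow: "order_le (b ^ k) (int k * s) \<and> coeff_Y (b ^ k) (int k * s) = lead b ^ k" for k
  proof (induction k)
    case 0
    show ?case using order_le_ord[of "1 :: 'k weyl"] by simp
  next
    case (Suc k)
    then show ?case
      using mult_expansion(1,2)[OF order_le_ord[of b], of "b ^ k" "int k * s"]
      by (simp add: s_def lead_def algebra_simps)
  qed
  have 1: "order_le (?D b * b ^ Suc n) ?N"
      "coeff_Y (?D b * b ^ Suc n) ?N = lead (?D b) * lead b ^ Suc n"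
    using mult_expansion(1,2)[OF order_le_ord[of "?D b"], of "b ^ Suc n" "int (Suc n) * s"]
      pow[of "Suc n"] by (simp_all add: t_def lead_def add.commute)
  have 2: "order_le (b * ?D (b ^ Suc n)) ?N"
      "coeff_Y (b * ?D (b ^ Suc n)) ?N
        = lead b * (of_nat (Suc n) * lead b ^ n * lead (?D b))"
    using mult_expansion(1,2)[OF order_le_ord[of b], of "?D (b ^ Suc n)" "int n * s + t"] Suc.IH
    by (simp_all add: s_def lead_def algebra_simps)
  have "?D (b ^ Suc (Suc n)) = ?D b * b ^ Suc n + b * ?D (b ^ Suc n)"
    using commutator_mult_right[of a b "b ^ Suc n"] by simp
  then show ?case
    using 1 2 by (simp add: order_le_add algebra_simps)
qed

lemma ord_commutator_power_right:
  fixes a b :: "'k::field_char_0 weyl"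
  assumes "commutator a b \<noteq> 0" "0 < n"
  shows "commutator a (b ^ n) \<noteq> 0"
    and "ord (commutator a (b ^ n)) = int (n - 1) * ord b + ord (commutator a b)"
proof -
  have "b \<noteq> 0" using assms by (auto simp: commutator_def)
  obtain m where n: "n = Suc m" using assms gr0_implies_Suc by blast
  note * = commutator_power_right_expansion[of a b m]
  have "of_nat (Suc m) * lead b ^ m * lead (commutator a b) \<noteq> 0"
    using lead_nonzero[OF \<open>b \<noteq> 0\<close>] lead_nonzero[OF assms(1)] by (simp del: of_nat_Suc)
  then have "coeff_Y (commutator a (b ^ n)) (int m * ord b + ord (commutator a b)) \<noteq> 0"
    using * by (simp add: n)
  from lead_eqI(1,2)[OF _ this] *
  show "commutator a (b ^ n) \<noteq> 0"
    and "ord (commutator a (b ^ n)) = int (n - 1) * ord b + ord (commutator a b)"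
    by (simp_all add: n)
qed

text \<open>This crude bound makes \<open>ord (D b) - ord b\<close> bounded above, so that a
  maximizer can be chosen.\<close>

lemma order_le_commutator: "order_le (commutator a b) (ord a + ord b)"
  unfolding commutator_def
  using mult_expansion(1)[OF order_le_ord order_le_ord]
  by (metis add.commute order_le_diff)

lemma subalgebra_centralizer: "subalgebra (centralizer a)"
  unfolding subalgebra_def weyl.subspace_def centralizer_def
  by (auto simp: algebra_simps weyl_scale_mult_left weyl_scale_mult_right)
    (metis mult.assoc)

lemma subalgebra_power: "subalgebra S \<Longrightarrow> a \<in> S \<Longrightarrow> a ^ n \<in> S"
  by (induction n) (auto simp: subalgebra_def)

section \<open>The centralizer of z for a pair with commutator 1\<close>

locale weyl_pair =
  fixes x y :: "'k::field_char_0 weyl"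
  assumes pair: "commutator y x = 1"
begin

abbreviation z :: "'k weyl" where "z \<equiv> y * x"

abbreviation C :: "'k weyl set" where "C \<equiv> centralizer z"

abbreviation D :: "'k weyl \<Rightarrow> 'k weyl" where "D \<equiv> commutator y"

lemma yx: "y * x = x * y + 1"
  using pair by (simp add: commutator_def algebra_simps)

lemma nonzero: "x \<noteq> 0" "y \<noteq> 0" "z \<noteq> 0"
  using pair by (auto simp: commutator_def)

lemma ord_z: "ord z = ord x + ord y"
  using nonzero by (simp add: mult_lead add.commute)

lemma ord_z_pos: "0 < ord z"
proof (rule ccontr)
  assume "\<not> 0 < ord z"
  then have "ord x = 0" "ord y = 0"
    using ord_z ord_nonneg[of x] ord_nonneg[of y] by simp_all
  \<comment> \<open>Elements of order 0 lie in K[X] and commute, contradicting [y, x] = 1.\<close>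
  then obtain p q where "x = weyl_of_poly p" "y = weyl_of_poly q"
    using ord_0E by metis
  then show False
    using pair weyl_of_poly_commute[of p q] by (simp add: commutator_def)
qed

lemma D_z: "D z = y"
  using pair by (simp add: commutator_mult_right) (simp add: commutator_def)

lemma C_closed:
  shows C_1: "1 \<in> C" and C_z: "z \<in> C"
    and C_power: "\<And>a n. a \<in> C \<Longrightarrow> a ^ n \<in> C"
    and C_scale: "\<And>a c. a \<in> C \<Longrightarrow> weyl_scale c a \<in> C"
    and C_diff: "\<And>a b. a \<in> C \<Longrightarrow> b \<in> C \<Longrightarrow> a - b \<in> C"
  using subalgebra_centralizer[of z]
  by (auto simp: subalgebra_def subalgebra_power weyl.subspace_scale weyl.subspace_diff)
    (simp add: centralizer_def)

lemma C_same_order: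
  assumes "a \<in> C" "b \<in> C" "a \<noteq> 0" "b \<noteq> 0" "ord a = ord b"
  obtains c r where "c \<noteq> 0" "a = weyl_scale c b + r" "r \<in> C" "order_le r (ord b - 1)"
proof -
  obtain c where "c \<noteq> 0" "order_le (a - weyl_scale c b) (ord b - 1)"
    using commuting_proportional[OF ord_z_pos, of a b] assms by (auto simp: centralizer_def)
  then show ?thesis
    using assms by (intro that[of c "a - weyl_scale c b"]) (auto intro: C_diff C_scale)
qed

text \<open>Comparison with \<open>1\<close> leaves a remainder of order at most -1, that is,
  zero.\<close>

lemma C_order_0:
  assumes "a \<in> C" "ord a = 0"
  obtains c where "a = weyl_scale c 1"
proof (cases "a = 0")
  case True
  then show ?thesis using that[of 0] by simp
next
  case False
  obtain c r where "a = weyl_scale c 1 + r" "order_le r (ord (1 :: 'k weyl) - 1)"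
    using C_same_order[OF assms(1) C_1 False] assms(2) by (metis ord_1 one_neq_zero)
  then show ?thesis
    using that[of c] ord_nonneg[of r] by (simp add: order_le_iff)
qed

lemma C_power_relation:
  assumes "b \<in> C" "0 < ord b"
  obtains c r n m where "c \<noteq> 0" "b ^ n = weyl_scale c (z ^ m) + r" "r \<in> C"
    "order_le r (int n * ord b - 1)" "0 < n" "0 < m" "int n * ord b = int m * ord z"
proof -
  have "b \<noteq> 0" using assms(2) by (auto simp: ord_def)
  \<comment> \<open>Crossed exponents give both powers the order
    \<open>ord z * ord b\<close>.\<close>
  let ?n = "nat (ord z)" and ?m = "nat (ord b)"
  have "ord (b ^ ?n) = ord (z ^ ?m)"
    using assms ord_z_pos nonzero \<open>b \<noteq> 0\<close> by (simp add: ord_power)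
  then obtain c r where "c \<noteq> 0" "b ^ ?n = weyl_scale c (z ^ ?m) + r" "r \<in> C"
    "order_le r (ord (z ^ ?m) - 1)"
    using C_same_order[of "b ^ ?n" "z ^ ?m"] assms(1) nonzero \<open>b \<noteq> 0\<close> C_z C_power by auto
  then show ?thesis
    using that[of c ?n ?m r] assms(2) ord_z_pos nonzero by (simp add: ord_power mult.commute)
qed

lemma ord_D_z_power:
  assumes "0 < m" "c \<noteq> 0"
  shows "weyl_scale c (D (z ^ m)) \<noteq> 0"
    and "ord (weyl_scale c (D (z ^ m))) = int m * ord z - ord z + ord y"
  using ord_commutator_power_right[of y z m] assms nonzero D_z
  by (simp_all add: ord_scale of_nat_diff algebra_simps)

section \<open>The order of \<open>D b\<close> on the centralizer\<close>

lemma ord_D_le: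
  assumes "b \<in> C" "D b \<noteq> 0"
  shows "ord (D b) \<le> ord b + ord y - ord z"
proof (rule ccontr)
  let ?P = "\<lambda>b. b \<in> C \<and> D b \<noteq> 0 \<and> ord b + ord y - ord z < ord (D b)"
  \<comment> \<open>Adding \<open>ord z\<close> makes the integer positive wherever
    \<open>?P\<close> holds, so \<open>nat\<close> truncates nothing there.\<close>
  let ?f = "\<lambda>b. nat (ord (D b) - ord b + ord z)"
  assume "\<not> ?thesis"
  with assms have "?P b" by simp
  moreover have "\<forall>a. ?P a \<longrightarrow> ?f a < Suc (nat (ord y + ord z))"
  proof (intro allI impI le_imp_less_Suc nat_mono)
    fix a assume "?P a"
    then show "ord (D a) - ord a + ord z \<le> ord y + ord z"
      using order_le_commutator[of y a] by (simp add: order_le_iff)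
  qed
  ultimately obtain a where a: "?P a" and max: "\<And>r. ?P r \<Longrightarrow> ?f r \<le> ?f a"
    using ex_has_greatest_nat[of ?P b ?f "Suc (nat (ord y + ord z))"] by metis
  have "ord a \<noteq> 0"
  proof
    assume "ord a = 0"
    then obtain c where "a = weyl_scale c 1"
      using C_order_0 a by blast
    then have "D a = weyl_scale c (D 1)"
      by (simp only: commutator_scale_right)
    then show False
      using a by (simp add: commutator_def[of y 1])
  qed
  then have "0 < ord a" using ord_nonneg[of a] by simp
  with a obtain c r n m where rel: "c \<noteq> 0" "a ^ n = weyl_scale c (z ^ m) + r" "r \<in> C"
    "order_le r (int n * ord a - 1)" "0 < n" "0 < m" "int n * ord a = int m * ord z"
    using C_power_relation by metis
  let ?u = "D (a ^ n)" and ?v = "weyl_scale (- c) (D (z ^ m))"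
  have u: "?u \<noteq> 0" "ord ?u = int n * ord a - ord a + ord (D a)"
    using ord_commutator_power_right[of y a n] a rel(5)
    by (simp_all add: of_nat_diff algebra_simps)
  have v: "ord ?v = int n * ord a - ord z + ord y"
    using ord_D_z_power[of m "- c"] rel by simp
  have Dr: "D r = ?u + ?v"
    by (simp add: rel(2) commutator_add_right commutator_scale_right)
  \<comment> \<open>The difference of the two orders is exactly the amount by which \<open>a\<close>
    exceeds the claimed bound.\<close>
  have "ord ?v < ord ?u"
    using u v a by simp
  then have "D r \<noteq> 0" "ord (D r) = ord ?u"
    unfolding Dr by (rule ord_add_lower[OF u(1) order_le_ord])+
  moreover from this have "ord r \<le> int n * ord a - 1"
    using rel(4) by (auto simp: order_le_iff commutator_def)
  \<comment> \<open>\<open>D r\<close> has order \<open>int n * ord a - ord a + ord (D a)\<close>,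
    while \<open>r\<close> has order below \<open>int n * ord a\<close>; so \<open>?f r\<close>
    exceeds the maximum \<open>?f a\<close>.\<close>
  ultimately show False
    using max[of r] a u rel(3) ord_nonneg[of y] by auto
qed

text \<open>The upper bound, applied to the remainder \<open>r\<close> in
  \<open>b ^ n = weyl_scale c (z ^ m) + r\<close>, shows that \<open>D (z ^ m)\<close> dominates.
  This fixes the order of \<open>D (b ^ n)\<close>, and the power formula then gives that of
  \<open>D b\<close>.\<close>

lemma ord_D:
  assumes "b \<in> C" "0 < ord b"
  shows "D b \<noteq> 0" "ord (D b) = ord b + ord y - ord z"
proof -
  obtain c r n m where rel: "c \<noteq> 0" "b ^ n = weyl_scale c (z ^ m) + r" "r \<in> C"
    "order_le r (int n * ord b - 1)" "0 < n" "0 < m" "int n * ord b = int m * ord z"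
    using C_power_relation assms by metis
  let ?v = "weyl_scale c (D (z ^ m))"
  have v: "?v \<noteq> 0" "ord ?v = int n * ord b - ord z + ord y"
    using ord_D_z_power[of m c] rel by simp_all
  have "order_le (D r) (int n * ord b - 1 + ord y - ord z)"
    using ord_D_le[OF rel(3)] rel(4)
    by (cases "D r = 0"; cases "r = 0") (auto simp: order_le_iff commutator_def[of y 0])
  then have "?v + D r \<noteq> 0" "ord (?v + D r) = ord ?v"
    using ord_add_lower[OF v(1)] v(2) by simp_all
  then have n: "D (b ^ n) \<noteq> 0" "ord (D (b ^ n)) = ord ?v"
    by (simp_all add: rel(2) commutator_add_right commutator_scale_right)
  show "D b \<noteq> 0"
  proof
    assume "D b = 0"
    then have "D (b ^ k) = 0" for k
      by (induction k) (simp_all add: commutator_mult_right, simp add: commutator_def)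
    with n show False by simp
  qed
  then show "ord (D b) = ord b + ord y - ord z"
    using ord_commutator_power_right[of y b n] n v rel(5)
    by (simp add: of_nat_diff algebra_simps)
qed

section \<open>Descent of orders and the generated subalgebra\<close>

lemma C_lower:
  assumes "b \<in> C" "0 < ord b"
  shows "commutator x (D b) \<in> C" "commutator x (D b) \<noteq> 0"
    and "ord (commutator x (D b)) = ord b - ord z"
proof -
  let ?w = "commutator x (D b)" and ?e = "D b * x"
  have zb: "z * b = b * z" using assms by (simp add: centralizer_def)
  \<comment> \<open>Under [z, .] the elements \<open>x\<close> and \<open>y\<close> are eigenvectors
    for 1 and -1. Since \<open>b\<close> commutes with \<open>z\<close>, \<open>D b\<close> also
    satisfies the equation for -1, and its products with \<open>x\<close> have weight 0.\<close>
  have zx: "z * x = x * z + x"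
    using arg_cong[OF yx, of "\<lambda>t. t * x"] by (simp add: algebra_simps)
  have zy: "z * y = y * z - y"
    using arg_cong[OF yx, of "\<lambda>t. y * t"] by (simp add: algebra_simps)
  have zD: "z * D b = D b * z - D b"
  proof -
    have 1: "(z * y) * b = y * (b * z) - y * b"
      unfolding zy using zb by (simp add: left_diff_distrib mult.assoc)
    have 2: "(z * b) * y = b * (y * z) - b * y"
      unfolding zb mult.assoc[of b z y] zy by (simp add: right_diff_distrib)
    have "z * D b = (z * y) * b - (z * b) * y"
      by (simp only: commutator_def right_diff_distrib mult.assoc)
    also have "\<dots> = D b * z - D b"
      unfolding 1 2 by (simp add: commutator_def algebra_simps)
    finally show ?thesis .
  qed
  have ze: "z * ?e = ?e * z"
  proof -
    have "z * ?e = (z * D b) * x" by (simp only: mult.assoc)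
    also have "\<dots> = D b * (z * x) - D b * x"
      unfolding zD by (simp only: left_diff_distrib mult.assoc)
    also have "\<dots> = ?e * z" unfolding zx by (simp add: algebra_simps)
    finally show ?thesis .
  qed
  have zf: "z * (x * D b) = (x * D b) * z"
  proof -
    have "z * (x * D b) = (z * x) * D b" by (simp only: mult.assoc)
    also have "\<dots> = x * (z * D b) + x * D b" unfolding zx by (simp only: distrib_right mult.assoc)
    also have "\<dots> = (x * D b) * z" unfolding zD by (simp add: algebra_simps)
    finally show ?thesis .
  qed
  have e: "?e \<in> C" using ze by (simp add: centralizer_def)
  have "x * D b \<in> C" using zf by (simp add: centralizer_def)
  with e show "?w \<in> C" unfolding commutator_def[of x] by (rule C_diff[rotated])
  \<comment> \<open>Positive order of \<open>?e\<close> is needed in order to apply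
    \<open>ord_D\<close> a second time.\<close>
  have ord_e: "ord ?e = ord b"
    using ord_D[OF assms] nonzero ord_z by (simp add: mult_lead)
  have De: "D ?e \<noteq> 0" "ord (D ?e) = ord b + ord y - ord z"
    using ord_D[OF e] ord_e assms(2) by simp_all
  have xy: "x * y = z - 1" using yx by simp
  have "(x * y) * ?e = ?e * (x * y)"
    unfolding xy using ze by (simp add: algebra_simps)
  \<comment> \<open>Expanding gives \<open>x * ?e * y - ?e * (x * y)\<close>; moving
    \<open>x * y\<close> to the left of \<open>?e\<close> turns this into
    \<open>- x * (y * ?e - ?e * y)\<close>.\<close>
  then have w: "?w * (x * y) = - (x * D ?e)"
    by (simp add: commutator_def[of x] commutator_def[of y ?e] algebra_simps)
  then show w0: "?w \<noteq> 0" using De nonzero by auto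
  have "ord (?w * (x * y)) = ord (x * D ?e)"
    unfolding w using ord_scale[of "- 1" "x * D ?e"] by simp
  then show "ord ?w = ord b - ord z"
    using w0 De nonzero ord_z by (simp add: mult_lead)
qed

lemma ord_z_dvd: "b \<in> C \<Longrightarrow> ord z dvd ord b"
proof (induction "nat (ord b)" arbitrary: b rule: less_induct)
  case less
  show ?case
  proof (cases "ord b = 0")
    case False
    then have pos: "0 < ord b" using ord_nonneg[of b] by simp
    note w = C_lower[OF less.prems pos]
    have "ord z dvd ord b - ord z"
      using less.hyps[of "commutator x (D b)"] w ord_z_pos pos by simp
    then show ?thesis by (metis diff_add_cancel dvd_add_triv_right_iff)
  qed simp
qed

text \<open>Subtracting a multiple of \<open>z ^ k\<close> with \<open>k = ord b / ord z\<close>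
  lowers the order; divisibility supplies this \<open>k\<close>. An arbitrary \<open>S\<close> suits
  \<open>generated_subalgebra\<close>, which is an intersection of such sets.\<close>

lemma C_subset:
  assumes S: "subalgebra S" "z \<in> S"
  shows "b \<in> C \<Longrightarrow> b \<in> S"
proof (induction "nat (ord b)" arbitrary: b rule: less_induct)
  case less
  have scale: "weyl_scale c (z ^ k) \<in> S" for c k
    using S subalgebra_power[OF S] by (auto simp: subalgebra_def weyl.subspace_scale)
  show ?case
  proof (cases "ord b = 0")
    case True
    with less.prems obtain c where "b = weyl_scale c 1" by (rule C_order_0)
    then show ?thesis using scale[of c 0] by simp
  next
    case False
    then have pos: "0 < ord b" using ord_nonneg[of b] by simp
    obtain k' where k': "ord b = ord z * k'"
      using ord_z_dvd[OF less.prems] by (elim dvdE)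
    define k where "k = nat k'"
    have "0 < k'" using k' pos ord_z_pos by (simp add: zero_less_mult_iff)
    then have k: "ord (z ^ k) = ord b"
      using nonzero k' by (simp add: k_def ord_power mult.commute)
    have "b \<noteq> 0" using pos by (auto simp: ord_def)
    obtain c r where r: "b = weyl_scale c (z ^ k) + r" "r \<in> C" "order_le r (ord (z ^ k) - 1)"
      using C_same_order[OF less.prems C_power[OF C_z] \<open>b \<noteq> 0\<close> _ k[symmetric]] nonzero
      by (metis power_not_zero)
    have "r \<in> S"
    proof (cases "r = 0")
      case True
      then show ?thesis using S by (simp add: subalgebra_def weyl.subspace_0)
    next
      case False
      then have "nat (ord r) < nat (ord b)"
        using r(3) k pos by (simp add: order_le_iff)
      then show ?thesis using less.hyps r(2) by blast
    qed
    then show ?thesis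
      using r(1) scale S by (simp add: subalgebra_def weyl.subspace_add)
  qed
qed

end

theorem theorem1p1:
  fixes x y :: "'k::field_char_0 weyl"
  assumes "commutator y x = 1"
  shows "centralizer (y * x) = generated_subalgebra (y * x)"
proof
  interpret weyl_pair x y
    by standard (rule assms)
  show "centralizer (y * x) \<subseteq> generated_subalgebra (y * x)"
    unfolding generated_subalgebra_def hull_def using C_subset by auto
  show "generated_subalgebra (y * x) \<subseteq> centralizer (y * x)"
    unfolding generated_subalgebra_def
    using subalgebra_centralizer C_z by (intro hull_minimal) auto
qed

end
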